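(* Let $n=2$ and $p\in(0,1/2)$. Let $\Omega\subsetneq\mathbb{R}^2$ be an unbounded convex domain. Then there is no positive convex function $u\in C^2(\Omega)$ solving $\det D^2u=u^p$ in $\Omega$ with $\lim_{x\to\partial\Omega}u(x)=\infty$. *)

theory Defs
  imports "HOL-Analysis.Analysis"
begin

text \<open>u is C^2 on the open set S, with gradient field g and Hessian matrix field H:
  Du(x) h = g x \<bullet> h, Dg(x) h = H x *v h, and H continuous on S.
  On an open set g and H are uniquely determined by u, so D^2 u(x) = H x.\<close>
definition C2_with_hessian ::
  "(real^2 \<Rightarrow> real) \<Rightarrow> (real^2 \<Rightarrow> real^2) \<Rightarrow> (real^2 \<Rightarrow> real^2^2) \<Rightarrow> (real^2) set \<Rightarrow> bool" where
  "C2_with_hessian u g H S \<longleftrightarrow>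
     (\<forall>x\<in>S. (u has_derivative (\<lambda>h. g x \<bullet> h)) (at x)) \<and>
     (\<forall>x\<in>S. (g has_derivative (\<lambda>h. H x *v h)) (at x)) \<and>
     continuous_on S H"

end

theory Submission
  imports Defs
begin

text \<open>
  Put \<open>\<alpha> = 2 / (2 - p)\<close>. Comparing u with multiples of the power \<open>\<alpha>\<close> of a definite
  quadratic form shows that an ellipse on which \<open>u \<le> N\<close> has area at most \<open>C * N powr (1 / \<alpha>)\<close>.
  Applied in the convex hull of a point x and a fixed ball, this bounds \<open>norm x\<close> by
  \<open>C * u x powr (1 / \<alpha>)\<close> at infinity, so u grows superlinearly and its sublevel sets are compact.

  Let \<open>t > 0\<close> be the distance to a supporting line through a boundary point. For \<open>k = 2 ^ j\<close> minimise
  \<open>u + k * t\<close>; let N be the value of u at the minimiser and consider the section cut off by the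
  plane of slope \<open>- k\<close> in t lying N above the tangent one. As k grows, N tends to infinity and the width
  of the section in the direction of t tends to 0, while its length is at most
  \<open>C * K powr (1 / \<alpha>)\<close> if the plane is at most K on it. Comparing u with a quadratic polynomial on the
  section gives the Alexandrov-type estimate \<open>N\<^sup>2 \<le> o(1) * K powr (2 / \<alpha>) * K powr p = o(1) * K\<^sup>2\<close>.
  One may take \<open>K = 4 * N\<close> for infinitely many j: otherwise N at least doubles at every step, and then
  t decreases by a fixed amount at every step. This is a contradiction.
\<close>

section \<open>Second-derivative test in one variable\<close>

lemma second_derivative_nonpos_at_local_max:
  fixes f f' :: "real \<Rightarrow> real"
  assumes "0 < d"
    and f: "\<And>t. \<bar>t\<bar> < d \<Longrightarrow> (f has_real_derivative f' t) (at t)"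
    and f': "(f' has_real_derivative D) (at 0)"
    and max: "\<And>t. \<bar>t\<bar> < d \<Longrightarrow> f t \<le> f 0"
  shows "D \<le> 0"
proof (rule ccontr)
  assume "\<not> D \<le> 0"
  then obtain d' where d': "d' > 0" "\<And>h. 0 < h \<Longrightarrow> h < d' \<Longrightarrow> f' 0 < f' (0 + h)"
    using DERIV_pos_inc_right[OF f'] by (auto simp: not_le)
  have "f' 0 = 0"
    using DERIV_local_max[OF f[of 0] \<open>0 < d\<close>] max \<open>0 < d\<close> by auto
  define m where "m = min d d' / 2"
  have m: "0 < m" "m < d" "m < d'" using \<open>0 < d\<close> d'(1) by (auto simp: m_def)
  have "f 0 < f m"
  proof (rule DERIV_pos_imp_increasing_open[OF m(1)])
    fix x assume "0 < x" "x < m"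
    then show "\<exists>y. DERIV f x :> y \<and> y > 0"
      using f[of x] d'(2)[of x] \<open>f' 0 = 0\<close> m by (intro exI[of _ "f' x"]) auto
  next
    show "continuous_on {0..m} f"
      by (intro continuous_at_imp_continuous_on ballI DERIV_isCont[OF f]) (use m in auto)
  qed
  with max[of m] m show False by simp
qed

section \<open>Rotated orthonormal frames of the plane and the determinant in them\<close>

definition perp :: "real^2 \<Rightarrow> real^2"
  where "perp e = vector [- e $ 2, e $ 1]"

lemma inner_real2: "x \<bullet> y = x $ 1 * y $ 1 + x $ 2 * y $ 2" for x y :: "real^2"
  by (simp add: inner_vec_def sum_2)

lemma perp_nth [simp]: "perp e $ 1 = - e $ 2" "perp e $ 2 = e $ 1"
  by (simp_all add: perp_def)

lemma inner_perp [simp]: "e \<bullet> perp e = 0" "perp e \<bullet> e = 0" "perp e \<bullet> perp e = e \<bullet> e"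
  by (simp_all add: inner_real2)

lemma norm_perp [simp]: "norm (perp e) = norm e"
  by (simp add: norm_eq_sqrt_inner)

lemma perp_expansion:
  assumes "norm e = 1"
  shows "x = (x \<bullet> e) *\<^sub>R e + (x \<bullet> perp e) *\<^sub>R perp e"
proof -
  have e: "e $ 1 * e $ 1 + e $ 2 * e $ 2 = 1"
    using assms by (simp add: norm_eq_sqrt_inner inner_real2)
  have "x $ 1 = x $ 1 * (e $ 1 * e $ 1 + e $ 2 * e $ 2)" "x $ 2 = x $ 2 * (e $ 1 * e $ 1 + e $ 2 * e $ 2)"
    by (simp_all only: e mult_1_right)
  then show ?thesis
    by (simp add: vec_eq_iff forall_2 inner_real2 algebra_simps)
qed

text \<open>The determinant is invariant under the rotation to the frame \<open>e\<close>,
  \<open>perp e\<close>; for general \<open>e\<close> the right-hand side carries the fourth power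
  of the norm of \<open>e\<close>.\<close>

lemma det_perp_basis:
  fixes A :: "real^2^2"
  assumes "norm e = 1"
  shows "det A = (e \<bullet> (A *v e)) * (perp e \<bullet> (A *v perp e)) - (e \<bullet> (A *v perp e)) * (perp e \<bullet> (A *v e))"
proof -
  have e: "e $ 1 * e $ 1 + e $ 2 * e $ 2 = 1"
    using assms by (simp add: norm_eq_sqrt_inner inner_real2)
  have "(e \<bullet> (A *v e)) * (perp e \<bullet> (A *v perp e)) - (e \<bullet> (A *v perp e)) * (perp e \<bullet> (A *v e))
     = det A * (e $ 1 * e $ 1 + e $ 2 * e $ 2)^2"
    by (simp add: inner_real2 det_2 matrix_vector_mult_def sum_2) algebra
  then show ?thesis using e by simp
qed

section \<open>C^2 functions in the plane: symmetry of the Hessian and comparison at extrema\<close>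

locale C2_function =
  fixes u :: "real^2 \<Rightarrow> real" and g :: "real^2 \<Rightarrow> real^2" and H :: "real^2 \<Rightarrow> real^2^2"
    and S :: "(real^2) set"
  assumes open_S: "open S" and C2: "C2_with_hessian u g H S"
begin

lemma continuous_on_u: "T \<subseteq> S \<Longrightarrow> continuous_on T u"
  using C2 unfolding C2_with_hessian_def
  by (meson continuous_at_imp_continuous_on has_derivative_continuous subsetD)

lemma DERIV_u_line:
  assumes "x + t *\<^sub>R h \<in> S"
  shows "((\<lambda>s. u (x + s *\<^sub>R h)) has_real_derivative g (x + t *\<^sub>R h) \<bullet> h) (at t)"
proof -
  have "(u has_derivative (\<lambda>h'. g (x + t *\<^sub>R h) \<bullet> h')) (at (x + t *\<^sub>R h))"
    using C2 assms by (auto simp: C2_with_hessian_def)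
  moreover have "((\<lambda>s. x + s *\<^sub>R h) has_derivative (\<lambda>s. s *\<^sub>R h)) (at t)"
    by (auto intro!: derivative_eq_intros)
  ultimately have "((\<lambda>s. u (x + s *\<^sub>R h)) has_derivative (\<lambda>s. g (x + t *\<^sub>R h) \<bullet> (s *\<^sub>R h))) (at t)"
    using has_derivative_compose by blast
  then show ?thesis
    by (simp add: has_field_derivative_def mult.commute[of _ "_ \<bullet> _"])
qed

lemma DERIV_g_line:
  assumes "x + t *\<^sub>R h \<in> S"
  shows "((\<lambda>s. g (x + s *\<^sub>R h) \<bullet> k) has_real_derivative k \<bullet> (H (x + t *\<^sub>R h) *v h)) (at t)"
proof -
  have "(g has_derivative (\<lambda>h'. H (x + t *\<^sub>R h) *v h')) (at (x + t *\<^sub>R h))"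
    using C2 assms by (auto simp: C2_with_hessian_def)
  moreover have "((\<lambda>s. x + s *\<^sub>R h) has_derivative (\<lambda>s. s *\<^sub>R h)) (at t)"
    by (auto intro!: derivative_eq_intros)
  ultimately have "((\<lambda>s. g (x + s *\<^sub>R h)) has_derivative (\<lambda>s. H (x + t *\<^sub>R h) *v (s *\<^sub>R h))) (at t)"
    using has_derivative_compose by blast
  then have "((\<lambda>s. g (x + s *\<^sub>R h) \<bullet> k) has_derivative (\<lambda>s. (H (x + t *\<^sub>R h) *v (s *\<^sub>R h)) \<bullet> k)) (at t)"
    by (rule has_derivative_inner_left)
  then show ?thesis
    by (simp add: has_field_derivative_def matrix_vector_mult_scaleR mult.commute[of _ "_ \<bullet> _"]
        inner_commute[of k])
qed

lemma line_in_ball: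
  assumes "ball x r \<subseteq> S" "norm h \<le> 1" "\<bar>t\<bar> < r"
  shows "x + t *\<^sub>R h \<in> S"
proof -
  have "norm (t *\<^sub>R h) \<le> \<bar>t\<bar> * 1" by (simp add: assms mult_left_le)
  then show ?thesis using assms by (auto simp: dist_norm)
qed

text \<open>Two applications of the mean value theorem, first along \<open>h\<close> and then along
  \<open>k\<close>, reduce the second difference to one Hessian entry at a nearby point. The
  difference itself is symmetric in \<open>h\<close> and \<open>k\<close>, which is what makes it
  useful.\<close>

lemma mixed_difference:
  assumes "ball x (2 * r) \<subseteq> S" "0 < t" "t < r" "norm h = 1" "norm k = 1"
  obtains y where "dist x y < 2 * t"
    "u (x + t *\<^sub>R h + t *\<^sub>R k) - u (x + t *\<^sub>R h) - u (x + t *\<^sub>R k) + u x = t * (t * (h \<bullet> (H y *v k)))"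
proof -
  have dist_add: "dist x (x + v) = norm v" for v
    by (simp add: dist_norm)
  have in_ball: "x + a *\<^sub>R h + b *\<^sub>R k \<in> S" if "0 \<le> a" "a \<le> t" "0 \<le> b" "b \<le> t" for a b
  proof -
    have "norm (a *\<^sub>R h + b *\<^sub>R k) \<le> a + b"
      using norm_triangle_ineq[of "a *\<^sub>R h" "b *\<^sub>R k"] assms that by simp
    then have "x + (a *\<^sub>R h + b *\<^sub>R k) \<in> ball x (2 * r)" 
      using assms that by (simp add: dist_add)
    then show ?thesis using assms(1) by (auto simp: add.assoc)
  qed
  define f where "f = (\<lambda>s. u ((x + t *\<^sub>R k) + s *\<^sub>R h) - u (x + s *\<^sub>R h))"
  have "(f has_real_derivative g ((x + t *\<^sub>R k) + s *\<^sub>R h) \<bullet> h - g (x + s *\<^sub>R h) \<bullet> h) (at s)"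
    if "0 \<le> s" "s \<le> t" for s
    unfolding f_def using in_ball[of s t] in_ball[of s 0] that assms
    by (intro DERIV_diff DERIV_u_line) (auto simp: algebra_simps)
  from MVT2[OF \<open>0 < t\<close> this] obtain s where s: "0 < s" "s < t"
    "f t - f 0 = t * (g ((x + t *\<^sub>R k) + s *\<^sub>R h) \<bullet> h - g (x + s *\<^sub>R h) \<bullet> h)"
    by auto
  have "((\<lambda>r. g ((x + s *\<^sub>R h) + r *\<^sub>R k) \<bullet> h) has_real_derivative
      h \<bullet> (H ((x + s *\<^sub>R h) + r *\<^sub>R k) *v k)) (at r)" if "0 \<le> r" "r \<le> t" for r
    using in_ball[of s r] that s assms by (intro DERIV_g_line) auto
  from MVT2[OF \<open>0 < t\<close> this] obtain r where r: "0 < r" "r < t"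
    "g ((x + s *\<^sub>R h) + t *\<^sub>R k) \<bullet> h - g (x + s *\<^sub>R h) \<bullet> h = t * (h \<bullet> (H ((x + s *\<^sub>R h) + r *\<^sub>R k) *v k))"
    by auto
  have "norm (s *\<^sub>R h + r *\<^sub>R k) \<le> s + r"
    using norm_triangle_ineq[of "s *\<^sub>R h" "r *\<^sub>R k"] assms s r by simp
  then have "dist x ((x + s *\<^sub>R h) + r *\<^sub>R k) < 2 * t"
    using s r dist_add[of "s *\<^sub>R h + r *\<^sub>R k"] by (simp add: add.assoc)
  moreover have "u (x + t *\<^sub>R h + t *\<^sub>R k) - u (x + t *\<^sub>R h) - u (x + t *\<^sub>R k) + u x = f t - f 0"
    by (simp add: f_def algebra_simps)
  ultimately show thesis using that s(3) r(3) by (simp add: algebra_simps)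
qed

text \<open>Evaluating the same second difference in both orders gives equal entries at points
  \<open>y n\<close> and \<open>z n\<close> tending to \<open>x\<close>; continuity of
  \<open>H\<close> passes to the limit.\<close>

lemma hessian_symmetric:
  assumes "x \<in> S" "norm h = 1" "norm k = 1"
  shows "h \<bullet> (H x *v k) = k \<bullet> (H x *v h)"
proof -
  obtain r where r: "0 < r" "ball x (2 * r) \<subseteq> S"
    using open_S assms(1) unfolding open_contains_ball
    by (metis field_sum_of_halves half_gt_zero mult_2)
  \<comment> \<open>The double successor makes \<open>t n < r\<close> strict already at
    \<open>n = 0\<close>.\<close>
  define t where "t n = r * inverse (real (Suc (Suc n)))" for n
  have t: "0 < t n" "t n < r" for n using r(1) by (auto simp: t_def field_simps intro!: add_pos_nonneg)
  have t0: "t \<longlonglongrightarrow> 0" unfolding t_def using LIMSEQ_Suc[OF LIMSEQ_inverse_real_of_nat] by (rule tendsto_mult_right_zero)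
  have "\<exists>y z. dist x y < 2 * t n \<and> dist x z < 2 * t n \<and> h \<bullet> (H y *v k) = k \<bullet> (H z *v h)" for n
  proof -
    obtain y where y: "dist x y < 2 * t n"
      "u (x + t n *\<^sub>R h + t n *\<^sub>R k) - u (x + t n *\<^sub>R h) - u (x + t n *\<^sub>R k) + u x = t n * (t n * (h \<bullet> (H y *v k)))"
      using mixed_difference[OF r(2) t(1) t(2) assms(2,3)] by blast
    obtain z where z: "dist x z < 2 * t n"
      "u (x + t n *\<^sub>R k + t n *\<^sub>R h) - u (x + t n *\<^sub>R k) - u (x + t n *\<^sub>R h) + u x = t n * (t n * (k \<bullet> (H z *v h)))"
      using mixed_difference[OF r(2) t(1) t(2) assms(3,2)] by blast
    have "t n * (t n * (h \<bullet> (H y *v k))) = t n * (t n * (k \<bullet> (H z *v h)))"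
      using y(2) z(2) by (simp add: algebra_simps)
    then show ?thesis using y(1) z(1) t(1)[of n] by auto
  qed
  then obtain y z where yz: "\<And>n. dist x (y n) < 2 * t n" "\<And>n. dist x (z n) < 2 * t n"
    "\<And>n. h \<bullet> (H (y n) *v k) = k \<bullet> (H (z n) *v h)"
    by metis
  have lim: "(\<lambda>n. a \<bullet> (H (w n) *v b)) \<longlonglongrightarrow> a \<bullet> (H x *v b)" if "\<And>n. dist x (w n) < 2 * t n" for w a b
  proof -
    have "w \<longlonglongrightarrow> x"
    proof (rule metric_tendsto_imp_tendsto)
      show "(\<lambda>n. 2 * t n) \<longlonglongrightarrow> 0" using tendsto_mult_left[OF t0, of 2] by simp
      show "\<forall>\<^sub>F n in sequentially. dist (w n) x \<le> dist (2 * t n) 0"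
        using that t(1) by (auto intro!: always_eventually simp: dist_commute less_imp_le
            abs_of_pos)
    qed
    moreover have "isCont H x"
      using C2 open_S assms(1) by (auto simp: C2_with_hessian_def continuous_on_eq_continuous_at)
    ultimately have "(\<lambda>n. H (w n)) \<longlonglongrightarrow> H x" by (rule isCont_tendsto_compose[rotated])
    then show ?thesis
      unfolding matrix_vector_mult_def inner_vec_def
      by (auto intro!: tendsto_intros)
  qed
  from lim[of y h k] lim[of z k h] yz show ?thesis
    using LIMSEQ_unique by fastforce
qed

text \<open>The second-derivative test on the line through \<open>x\<close> in direction
  \<open>h\<close>. The barriers used later enter only through their restrictions \<open>q\<close>
  to such lines.\<close>

lemma hessian_le_at_local_max:
  assumes "x \<in> S" "norm h = 1" "0 < d"
    and q: "\<And>t. \<bar>t\<bar> < d \<Longrightarrow> (q has_real_derivative q' t) (at t)"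
    and q': "(q' has_real_derivative D) (at 0)"
    and max: "\<And>t. \<bar>t\<bar> < d \<Longrightarrow> x + t *\<^sub>R h \<in> S \<Longrightarrow> u (x + t *\<^sub>R h) - q t \<le> u x - q 0"
  shows "h \<bullet> (H x *v h) \<le> D"
proof -
  obtain r where r: "0 < r" "ball x r \<subseteq> S"
    using open_S assms(1) unfolding open_contains_ball by blast
  have in_S: "x + t *\<^sub>R h \<in> S" if "\<bar>t\<bar> < min r d" for t
    using line_in_ball[OF r(2)] assms(2) that by auto
  have "h \<bullet> (H x *v h) - D \<le> 0"
  proof (rule second_derivative_nonpos_at_local_max)
    show "0 < min r d" using r assms(3) by simp
    show "((\<lambda>t. u (x + t *\<^sub>R h) - q t) has_real_derivative g (x + t *\<^sub>R h) \<bullet> h - q' t) (at t)"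
      if "\<bar>t\<bar> < min r d" for t
      using that in_S by (intro DERIV_diff DERIV_u_line q) auto
    show "((\<lambda>t. g (x + t *\<^sub>R h) \<bullet> h - q' t) has_real_derivative h \<bullet> (H x *v h) - D) (at 0)"
      using DERIV_g_line[of x 0 h h] assms(1) q' by (intro DERIV_diff) auto
    show "u (x + t *\<^sub>R h) - q t \<le> u (x + 0 *\<^sub>R h) - q 0" if "\<bar>t\<bar> < min r d" for t
      using max[of t] in_S that by auto
  qed
  then show ?thesis by simp
qed

lemma hessian_ge_at_local_min:
  assumes "x \<in> S" "norm h = 1" "0 < d"
    and q: "\<And>t. \<bar>t\<bar> < d \<Longrightarrow> (q has_real_derivative q' t) (at t)"
    and q': "(q' has_real_derivative D) (at 0)"
    and min: "\<And>t. \<bar>t\<bar> < d \<Longrightarrow> x + t *\<^sub>R h \<in> S \<Longrightarrow> u x - q 0 \<le> u (x + t *\<^sub>R h) - q t"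
  shows "D \<le> h \<bullet> (H x *v h)"
proof -
  obtain r where r: "0 < r" "ball x r \<subseteq> S"
    using open_S assms(1) unfolding open_contains_ball by blast
  have in_S: "x + t *\<^sub>R h \<in> S" if "\<bar>t\<bar> < min r d" for t
    using line_in_ball[OF r(2)] assms(2) that by auto
  have "D - h \<bullet> (H x *v h) \<le> 0"
  proof (rule second_derivative_nonpos_at_local_max)
    show "0 < min r d" using r assms(3) by simp
    show "((\<lambda>t. q t - u (x + t *\<^sub>R h)) has_real_derivative q' t - g (x + t *\<^sub>R h) \<bullet> h) (at t)"
      if "\<bar>t\<bar> < min r d" for t
      using that in_S by (intro DERIV_diff DERIV_u_line q) auto
    show "((\<lambda>t. q' t - g (x + t *\<^sub>R h) \<bullet> h) has_real_derivative D - h \<bullet> (H x *v h)) (at 0)"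
      using DERIV_g_line[of x 0 h h] assms(1) q' by (intro DERIV_diff) auto
    show "q t - u (x + t *\<^sub>R h) \<le> q 0 - u (x + 0 *\<^sub>R h)" if "\<bar>t\<bar> < min r d" for t
      using min[of t] in_S that by auto
  qed
  then show ?thesis by simp
qed

lemma hessian_nonneg:
  assumes "convex_on S u" "x \<in> S" "norm h = 1"
  shows "0 \<le> h \<bullet> (H x *v h)"
proof -
  obtain r where r: "0 < r" "ball x r \<subseteq> S"
    using open_S assms(2) unfolding open_contains_ball by blast
  have in_S: "x + t *\<^sub>R h \<in> S" if "\<bar>t\<bar> < r" for t
    using line_in_ball[OF r(2)] assms(3) that by auto
  have "- (h \<bullet> (H x *v h)) \<le> h \<bullet> (H x *v h)"
  \<comment> \<open>The comparison function is minus the reflection of \<open>u\<close> through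
    \<open>x\<close>: by convexity the sum of \<open>u\<close> and its reflection is minimal at
    \<open>x\<close>. This yields twice the claim.\<close>
  proof (rule hessian_ge_at_local_min[OF assms(2,3) r(1)])
    show "((\<lambda>t. - u (x + t *\<^sub>R (- h))) has_real_derivative - (g (x + t *\<^sub>R (- h)) \<bullet> (- h))) (at t)"
      if "\<bar>t\<bar> < r" for t
      using in_S[of "- t"] that by (intro DERIV_minus DERIV_u_line) auto
    show "((\<lambda>t. - (g (x + t *\<^sub>R (- h)) \<bullet> (- h))) has_real_derivative - (h \<bullet> (H x *v h))) (at 0)"
      using DERIV_g_line[of x 0 "- h" "- h"] assms(2)
      by (intro DERIV_minus) (auto simp: linear_neg matrix_vector_mul_linear)
    show "u x - - u (x + 0 *\<^sub>R (- h)) \<le> u (x + t *\<^sub>R h) - - u (x + t *\<^sub>R (- h))" if "\<bar>t\<bar> < r" for t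
    proof -
      have "u ((1/2) *\<^sub>R (x + t *\<^sub>R h) + (1/2) *\<^sub>R (x - t *\<^sub>R h)) \<le> 1/2 * u (x + t *\<^sub>R h) + 1/2 * u (x - t *\<^sub>R h)"
        using in_S[of t] in_S[of "- t"] that
        by (intro assms(1)[unfolded convex_on_def, THEN conjunct2, rule_format]) auto
      moreover have "(1/2) *\<^sub>R (x + t *\<^sub>R h) + (1/2) *\<^sub>R (x - t *\<^sub>R h) = x"
        by (simp add: algebra_simps flip: scaleR_left.add)
      ultimately show ?thesis by simp
    qed
  qed
  then show ?thesis by simp
qed

text \<open>By symmetry the off-diagonal entries contribute minus a square, which may be dropped.
  Convexity makes the diagonal entries nonnegative, so their bounds can be multiplied.\<close>

lemma det_hessian_le:
  assumes "convex_on S u" "x \<in> S" "norm e = 1"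
    and "e \<bullet> (H x *v e) \<le> a" "perp e \<bullet> (H x *v perp e) \<le> b"
  shows "det (H x) \<le> a * b"
proof -
  have "det (H x) \<le> (e \<bullet> (H x *v e)) * (perp e \<bullet> (H x *v perp e))"
    using det_perp_basis[OF assms(3), of "H x"] hessian_symmetric[OF assms(2), of e "perp e"] assms(3)
    by simp
  also have "\<dots> \<le> a * b"
    using assms hessian_nonneg[OF assms(1,2)]
    by (intro mult_mono) (auto intro: order_trans)
  finally show ?thesis .
qed

end

text \<open>Subtracting the diagonal form leaves a nonnegative form in \<open>s\<close> and
  \<open>t\<close>, so its discriminant is nonpositive. The form sees only the sum
  \<open>R + T\<close> of the off-diagonal entries, and their product is at most a quarter of the
  square of that sum.\<close>

lemma det_ge_of_quadratic_form_ge: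
  fixes A :: "real^2^2"
  assumes e: "norm e = 1" and "0 \<le> a" "0 \<le> b"
    and ge: "\<And>h. norm h = 1 \<Longrightarrow> a * (h \<bullet> e)\<^sup>2 + b * (h \<bullet> perp e)\<^sup>2 \<le> h \<bullet> (A *v h)"
  shows "a * b \<le> det A"
proof -
  define P Q R T where "P = e \<bullet> (A *v e)" and "Q = perp e \<bullet> (A *v perp e)"
    and "R = e \<bullet> (A *v perp e)" and "T = perp e \<bullet> (A *v e)"
  have ee: "e \<bullet> e = 1" using e by (simp add: dot_square_norm)
  have all: "a * (h \<bullet> e)\<^sup>2 + b * (h \<bullet> perp e)\<^sup>2 \<le> h \<bullet> (A *v h)" for h
  proof (cases "h = 0")
    case False
    have "h \<bullet> (A *v h) = (norm h)\<^sup>2 * (sgn h \<bullet> (A *v sgn h))"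
      using False by (simp add: sgn_div_norm matrix_vector_mult_scaleR power2_eq_square field_simps)
    moreover have "(h \<bullet> v)\<^sup>2 = (norm h)\<^sup>2 * (sgn h \<bullet> v)\<^sup>2" for v
      using False by (simp add: sgn_div_norm power2_eq_square field_simps)
    ultimately show ?thesis
      using mult_left_mono[OF ge[of "sgn h"], of "(norm h)\<^sup>2"] False
      by (simp add: norm_sgn algebra_simps)
  qed simp
  have form: "a * s\<^sup>2 + b * t\<^sup>2 \<le> P * s\<^sup>2 + (R + T) * s * t + Q * t\<^sup>2" for s t
    using all[of "s *\<^sub>R e + t *\<^sub>R perp e"] ee
    by (simp add: matrix_vector_right_distrib matrix_vector_mult_scaleR inner_add_left
        inner_add_right P_def Q_def R_def T_def power2_eq_square algebra_simps)
  have "a \<le> P" "b \<le> Q" using form[of 1 0] form[of 0 1] by simp_all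
  have "(R + T)\<^sup>2 \<le> 4 * ((P - a) * (Q - b))"
  proof (cases "P = a")
    case True
    have "R + T = 0"
    proof (rule ccontr)
      assume "R + T \<noteq> 0"
      \<comment> \<open>When \<open>P = a\<close>, the remaining form at \<open>t = 1\<close> is
        affine in \<open>s\<close>; this \<open>s\<close> gives it the value -1.\<close>
      with form[of "- (Q - b + 1) / (R + T)" 1] True show False by simp
    qed
    then show ?thesis using True by simp
  next
    case False
    with \<open>a \<le> P\<close> have pos: "0 < P - a" by simp
    \<comment> \<open>For \<open>t = - 2 * (P - a)\<close> the remaining form is minimal at
      \<open>s = R + T\<close>, and its value there is \<open>P - a\<close> times minus the
      discriminant.\<close>
    have "0 \<le> (P - a) * (R + T)\<^sup>2 - 2 * (P - a) * (R + T)\<^sup>2 + (Q - b) * (4 * (P - a)\<^sup>2)"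
      using form[of "R + T" "- 2 * (P - a)"] by (simp add: power2_eq_square algebra_simps)
    then have "0 \<le> (P - a) * (4 * ((P - a) * (Q - b)) - (R + T)\<^sup>2)"
      by (simp add: power2_eq_square algebra_simps)
    then show ?thesis using pos by (simp add: zero_le_mult_iff)
  qed
  moreover have "4 * (R * T) \<le> (R + T)\<^sup>2"
    using zero_le_power2[of "R - T"] by (simp add: power2_eq_square algebra_simps)
  ultimately have "R * T \<le> (P - a) * (Q - b)" by linarith
  moreover have "a * b \<le> P * Q - (P - a) * (Q - b)"
  proof -
    have "P * Q - (P - a) * (Q - b) = a * (Q - b) + b * (P - a) + a * b" by (simp add: algebra_simps)
    then show ?thesis using \<open>a \<le> P\<close> \<open>b \<le> Q\<close> assms(2,3) by simp
  qed
  ultimately show ?thesis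
    using det_perp_basis[OF e, of A] by (simp add: P_def Q_def R_def T_def)
qed

section \<open>Ellipses, and powers of quadratic forms restricted to lines\<close>

definition ellipse :: "real^2 \<Rightarrow> real^2 \<Rightarrow> real \<Rightarrow> real \<Rightarrow> (real^2) set"
  where "ellipse c e a b = {x. (((x - c) \<bullet> e) / a)\<^sup>2 + (((x - c) \<bullet> perp e) / b)\<^sup>2 \<le> 1}"

lemma ellipse_bounds:
  assumes "x \<in> ellipse c e a b" "0 < a" "0 < b"
  shows "\<bar>(x - c) \<bullet> e\<bar> \<le> a" "\<bar>(x - c) \<bullet> perp e\<bar> \<le> b"
proof -
  have "(((x - c) \<bullet> e) / a)\<^sup>2 \<le> 1" "(((x - c) \<bullet> perp e) / b)\<^sup>2 \<le> 1"
    using assms(1) by (auto simp: ellipse_def intro: order_trans[rotated])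
  then show "\<bar>(x - c) \<bullet> e\<bar> \<le> a" "\<bar>(x - c) \<bullet> perp e\<bar> \<le> b"
    using assms(2,3) by (auto simp: abs_square_le_1)
qed

lemma compact_ellipse:
  assumes "norm e = 1" "0 < a" "0 < b"
  shows "compact (ellipse c e a b)"
proof (rule compact_eq_bounded_closed[THEN iffD2, OF conjI])
  have "norm (x - c) \<le> a + b" if "x \<in> ellipse c e a b" for x
  proof -
    have "norm (x - c) = norm (((x - c) \<bullet> e) *\<^sub>R e + ((x - c) \<bullet> perp e) *\<^sub>R perp e)"
      using perp_expansion[OF assms(1), of "x - c"] by simp
    also have "\<dots> \<le> \<bar>(x - c) \<bullet> e\<bar> + \<bar>(x - c) \<bullet> perp e\<bar>"
      using norm_triangle_ineq[of "((x - c) \<bullet> e) *\<^sub>R e" "((x - c) \<bullet> perp e) *\<^sub>R perp e"] assms(1) by simp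
    finally show ?thesis using ellipse_bounds[OF that assms(2,3)] by linarith
  qed
  then show "bounded (ellipse c e a b)"
    by (intro boundedI[of _ "norm c + (a + b)"]) (smt (verit) norm_triangle_sub)
  show "closed (ellipse c e a b)"
    unfolding ellipse_def using assms by (intro closed_Collect_le continuous_intros) auto
qed

lemma DERIV_powr_of_square:
  fixes r c \<alpha> N :: real
  assumes "0 < c" "0 < r"
  shows "((\<lambda>t. N * ((a + t / r)\<^sup>2 + c) powr \<alpha>) has_real_derivative
      N * (\<alpha> * ((a + t / r)\<^sup>2 + c) powr (\<alpha> - 1) * (2 * (a + t / r) / r))) (at t)"
proof -
  have "0 < (a + t / r)\<^sup>2 + c" using assms by (simp add: add_nonneg_pos)
  moreover have "((\<lambda>t. (a + t / r)\<^sup>2 + c) has_real_derivative 2 * (a + t / r) / r) (at t)"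
    using assms by (auto intro!: derivative_eq_intros)
  ultimately show ?thesis
    by (intro DERIV_cmult) (use DERIV_fun_powr[where r = \<alpha>] in fastforce)
qed

text \<open>Along an axis of an ellipse one scaled coordinate is \<open>a + t / r\<close> and the
  rest is a constant \<open>c\<close>, so this bounds an axial second derivative of the barrier in
  \<open>ellipse_area_bound\<close>. The term with \<open>a\<^sup>2\<close> is absorbed by
  \<open>a\<^sup>2 \<le> a\<^sup>2 + c\<close>.\<close>

lemma DERIV2_powr_of_square:
  fixes r c \<alpha> N :: real
  assumes "0 < c" "0 < r" "0 < N" "1 \<le> \<alpha>"
  obtains D where "((\<lambda>t. N * (\<alpha> * ((a + t / r)\<^sup>2 + c) powr (\<alpha> - 1) * (2 * (a + t / r) / r)))
      has_real_derivative D) (at 0)"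
    "D \<le> 4 * \<alpha>\<^sup>2 * N * (a\<^sup>2 + c) powr (\<alpha> - 1) / r\<^sup>2"
proof
  let ?\<sigma> = "a\<^sup>2 + c"
  let ?D = "N * \<alpha> * (4 * (\<alpha> - 1) * (?\<sigma> powr (\<alpha> - 2) * a\<^sup>2) + 2 * ?\<sigma> powr (\<alpha> - 1)) / r\<^sup>2"
  have pos: "0 < ?\<sigma>" using assms by (simp add: add_nonneg_pos)
  show "((\<lambda>t. N * (\<alpha> * ((a + t / r)\<^sup>2 + c) powr (\<alpha> - 1) * (2 * (a + t / r) / r)))
      has_real_derivative ?D) (at 0)"
  proof -
    have "((\<lambda>t. ((a + t / r)\<^sup>2 + c) powr (\<alpha> - 1)) has_real_derivative
        (\<alpha> - 1) * (?\<sigma> powr (\<alpha> - 2) * (2 * a / r))) (at 0)"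
      using DERIV_powr_of_square[OF assms(1,2), of 1 a "\<alpha> - 1" 0]
      by (simp add: algebra_simps diff_divide_distrib)
    moreover have "((\<lambda>t. 2 * (a + t / r) / r) has_real_derivative 2 / r\<^sup>2) (at 0)"
      using assms by (auto intro!: derivative_eq_intros simp: power2_eq_square)
    ultimately have "((\<lambda>t. N * (\<alpha> * (((a + t / r)\<^sup>2 + c) powr (\<alpha> - 1) * (2 * (a + t / r) / r))))
        has_real_derivative N * (\<alpha> * ((\<alpha> - 1) * (?\<sigma> powr (\<alpha> - 2) * (2 * a / r)) * (2 * (a + 0 / r) / r)
          + 2 / r\<^sup>2 * ((a + 0 / r)\<^sup>2 + c) powr (\<alpha> - 1)))) (at 0)"
      by (intro DERIV_cmult DERIV_mult)
    moreover have "N * (\<alpha> * ((\<alpha> - 1) * (P * (2 * a / r)) * (2 * (a + 0 / r) / r) + 2 / r\<^sup>2 * R))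
        = N * \<alpha> * (4 * (\<alpha> - 1) * (P * a\<^sup>2) + 2 * R) / r\<^sup>2" for P R
      using assms by (simp add: field_simps power2_eq_square)
    ultimately show ?thesis by (simp add: mult.assoc)
  qed
  have "?\<sigma> powr (\<alpha> - 2) * a\<^sup>2 \<le> ?\<sigma> powr (\<alpha> - 2) * ?\<sigma>"
    using assms by (intro mult_left_mono) auto
  also have "\<dots> = ?\<sigma> powr (\<alpha> - 1)"
    using pos powr_add[of ?\<sigma> "\<alpha> - 2" 1] by simp
  finally have "(\<alpha> - 1) * (?\<sigma> powr (\<alpha> - 2) * a\<^sup>2) \<le> (\<alpha> - 1) * ?\<sigma> powr (\<alpha> - 1)"
    using assms by (intro mult_left_mono) auto
  then have "4 * (\<alpha> - 1) * (?\<sigma> powr (\<alpha> - 2) * a\<^sup>2) + 2 * ?\<sigma> powr (\<alpha> - 1)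
      \<le> 4 * ((\<alpha> - 1) * ?\<sigma> powr (\<alpha> - 1)) + 2 * ?\<sigma> powr (\<alpha> - 1)"
    unfolding mult.assoc by - (rule add_right_mono, rule mult_left_mono, assumption, simp)
  also have "\<dots> \<le> 4 * \<alpha> * ?\<sigma> powr (\<alpha> - 1)"
    by (simp add: algebra_simps)
  finally have "4 * (\<alpha> - 1) * (?\<sigma> powr (\<alpha> - 2) * a\<^sup>2) + 2 * ?\<sigma> powr (\<alpha> - 1)
      \<le> 4 * \<alpha> * ?\<sigma> powr (\<alpha> - 1)" .
  then have "N * \<alpha> * (4 * (\<alpha> - 1) * (?\<sigma> powr (\<alpha> - 2) * a\<^sup>2) + 2 * ?\<sigma> powr (\<alpha> - 1))
      \<le> N * \<alpha> * (4 * \<alpha> * ?\<sigma> powr (\<alpha> - 1))"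
    using assms by (intro mult_left_mono) auto
  then show "?D \<le> 4 * \<alpha>\<^sup>2 * N * ?\<sigma> powr (\<alpha> - 1) / r\<^sup>2"
    using assms by (intro divide_right_mono) (auto simp: power2_eq_square algebra_simps)
qed

section \<open>Area, growth and compactness estimates for blow-up solutions\<close>

locale blowup_solution = C2_function u g H S
  for u g H S +
  fixes p :: real
  assumes p_pos: "0 < p" and p_less: "p < 2"
    and convex_S: "convex S"
    and u_pos: "\<And>x. x \<in> S \<Longrightarrow> 0 < u x"
    and convex_u: "convex_on S u"
    and det_eq: "\<And>x. x \<in> S \<Longrightarrow> det (H x) = u x powr p"
    and blowup: "\<And>y. y \<in> frontier S \<Longrightarrow> filterlim u at_top (at y within S)"
begin

text \<open>The exponent at which both sides of the equation scale alike: the Hessian determinant of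
  a quadratic form raised to \<alpha> scales like the form to the power
  \<open>2 * \<alpha> - 2\<close>, which equals \<open>\<alpha> * p\<close>.\<close>

definition "\<alpha> = 2 / (2 - p)"

lemma alpha: "1 < \<alpha>" "\<alpha> * p = 2 * \<alpha> - 2"
  using p_pos p_less by (auto simp: \<alpha>_def field_simps)

text \<open>The barrier \<open>Q\<close> is at least \<open>N\<close>, hence at least
  \<open>u\<close>, on the boundary of the ellipse, but below \<open>u\<close> at its centre. At the
  interior maximum \<open>z\<close> of \<open>u - Q\<close> the determinant is at most the product
  of the bounds for the axial second derivatives of \<open>Q\<close>, while
  \<open>u z > Q z\<close>; by the choice of \<alpha> the powers of \<open>s z + \<epsilon>\<close>
  cancel.\<close>

lemma ellipse_area_bound:
  assumes e: "norm e = 1" and ab: "0 < a" "0 < b"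
    and sub: "ellipse c e a b \<subseteq> S" and le: "\<And>x. x \<in> ellipse c e a b \<Longrightarrow> u x \<le> N"
  shows "(a * b)\<^sup>2 \<le> 16 * \<alpha> ^ 4 * N powr (2 - p)"
proof -
  define s where "s x = (((x - c) \<bullet> e) / a)\<^sup>2 + (((x - c) \<bullet> perp e) / b)\<^sup>2" for x
  have E: "ellipse c e a b = {x. s x \<le> 1}" by (simp add: ellipse_def s_def)
  have s_cont: "continuous_on T s" for T
    unfolding s_def using ab by (intro continuous_intros) auto
  have s0: "0 \<le> s x" for x by (simp add: s_def)
  have c: "c \<in> ellipse c e a b" "s c = 0" by (simp_all add: E s_def)
  then have "0 < u c" using sub u_pos by blast
  with le c have N: "0 < N" by fastforce
  \<comment> \<open>Chosen so that \<open>Q c = u c / 2\<close>. Being positive, it also keeps the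
    base of the power away from 0 at the centre, so that \<open>Q\<close> is smooth there.\<close>
  define \<epsilon> where "\<epsilon> = (u c / (2 * N)) powr (1 / \<alpha>)"
  have \<epsilon>: "0 < \<epsilon>" using \<open>0 < u c\<close> N by (simp add: \<epsilon>_def)
  have \<epsilon>\<alpha>: "\<epsilon> powr \<alpha> = u c / (2 * N)"
    using alpha \<open>0 < u c\<close> N by (simp add: \<epsilon>_def powr_powr)
  define Q where "Q x = N * (s x + \<epsilon>) powr \<alpha>" for x
  have s_pos: "0 < s x + \<epsilon>" for x using s0[of x] \<epsilon> by linarith
  then have s_ne: "s x + \<epsilon> \<noteq> 0" for x by (metis less_irrefl)
  have "continuous_on (ellipse c e a b) (\<lambda>x. u x - Q x)"
    unfolding Q_def using sub
    by (intro continuous_intros continuous_on_u s_cont) (auto simp: s_ne)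
  moreover have "ellipse c e a b \<noteq> {}" using c(1) by blast
  ultimately have "\<exists>z\<in>ellipse c e a b. \<forall>x\<in>ellipse c e a b. u x - Q x \<le> u z - Q z"
    by (intro continuous_attains_sup compact_ellipse[OF e ab])
  then obtain z where z: "z \<in> ellipse c e a b"
    and z_max: "\<And>x. x \<in> ellipse c e a b \<Longrightarrow> u x - Q x \<le> u z - Q z"
    by blast
  have zS: "z \<in> S" using z sub by blast
  have "Q c < u c" using \<epsilon>\<alpha> N \<open>0 < u c\<close> c(2) by (simp add: Q_def)
  then have gt: "Q z < u z" using z_max[OF c(1)] by simp
  have "s z < 1"
  proof (rule ccontr)
    assume "\<not> s z < 1"
    then have "1 \<le> (s z + \<epsilon>) powr \<alpha>" using \<epsilon> alpha by (intro ge_one_powr_ge_zero) auto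
    then have "N \<le> Q z" using N by (simp add: Q_def)
    with gt le[OF z] show False by simp
  qed
  moreover have "open (s -` {..<1})"
    using s_cont[of UNIV] by (simp add: open_vimage)
  ultimately obtain d where d: "0 < d" "ball z d \<subseteq> s -` {..<1}"
    unfolding open_contains_ball by blast
  have near: "z + t *\<^sub>R h \<in> ellipse c e a b" if "\<bar>t\<bar> < d" "norm h = 1" for t h
  proof -
    have "z + t *\<^sub>R h \<in> ball z d" using that by (simp add: dist_norm)
    then show ?thesis using d(2) by (auto simp: E less_imp_le)
  qed
  have ee: "e \<bullet> e = 1" using e by (simp add: dot_square_norm)
  let ?x = "((z - c) \<bullet> e) / a" and ?y = "((z - c) \<bullet> perp e) / b"
  let ?B = "4 * \<alpha>\<^sup>2 * N * (s z + \<epsilon>) powr (\<alpha> - 1)"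
  have B1: "e \<bullet> (H z *v e) \<le> ?B / a\<^sup>2"
  proof -
    have c': "0 < ?y\<^sup>2 + \<epsilon>" using \<epsilon> by (simp add: add_nonneg_pos)
    obtain D where D: "((\<lambda>t. N * (\<alpha> * ((?x + t / a)\<^sup>2 + (?y\<^sup>2 + \<epsilon>)) powr (\<alpha> - 1) * (2 * (?x + t / a) / a)))
        has_real_derivative D) (at 0)"
      "D \<le> 4 * \<alpha>\<^sup>2 * N * (?x\<^sup>2 + (?y\<^sup>2 + \<epsilon>)) powr (\<alpha> - 1) / a\<^sup>2"
      using DERIV2_powr_of_square[OF c' ab(1) N less_imp_le[OF alpha(1)]] by blast
    have "e \<bullet> (H z *v e) \<le> D"
    proof (rule hessian_le_at_local_max[OF zS e d(1) DERIV_powr_of_square[OF c' ab(1)] D(1)])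
      have "Q (z + t *\<^sub>R e) = N * ((?x + t / a)\<^sup>2 + (?y\<^sup>2 + \<epsilon>)) powr \<alpha>" for t
        by (simp add: Q_def s_def inner_diff_left inner_add_left ee add_divide_distrib
            diff_divide_distrib algebra_simps)
      from this this[of 0] show "u (z + t *\<^sub>R e) - N * ((?x + t / a)\<^sup>2 + (?y\<^sup>2 + \<epsilon>)) powr \<alpha>
          \<le> u z - N * ((?x + 0 / a)\<^sup>2 + (?y\<^sup>2 + \<epsilon>)) powr \<alpha>" if "\<bar>t\<bar> < d" for t
        using z_max[OF near[OF that e]] by simp
    qed
    with D(2) show ?thesis by (simp add: s_def add.assoc)
  qed
  have B2: "perp e \<bullet> (H z *v perp e) \<le> ?B / b\<^sup>2"
  proof -
    have c': "0 < ?x\<^sup>2 + \<epsilon>" using \<epsilon> by (simp add: add_nonneg_pos)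
    have e': "norm (perp e) = 1" using e by simp
    obtain D where D: "((\<lambda>t. N * (\<alpha> * ((?y + t / b)\<^sup>2 + (?x\<^sup>2 + \<epsilon>)) powr (\<alpha> - 1) * (2 * (?y + t / b) / b)))
        has_real_derivative D) (at 0)"
      "D \<le> 4 * \<alpha>\<^sup>2 * N * (?y\<^sup>2 + (?x\<^sup>2 + \<epsilon>)) powr (\<alpha> - 1) / b\<^sup>2"
      using DERIV2_powr_of_square[OF c' ab(2) N less_imp_le[OF alpha(1)]] by blast
    have "perp e \<bullet> (H z *v perp e) \<le> D"
    proof (rule hessian_le_at_local_max[OF zS e' d(1) DERIV_powr_of_square[OF c' ab(2)] D(1)])
      have "Q (z + t *\<^sub>R perp e) = N * ((?y + t / b)\<^sup>2 + (?x\<^sup>2 + \<epsilon>)) powr \<alpha>" for t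
        by (simp add: Q_def s_def inner_diff_left inner_add_left ee add_divide_distrib
            diff_divide_distrib algebra_simps)
      from this this[of 0] show "u (z + t *\<^sub>R perp e) - N * ((?y + t / b)\<^sup>2 + (?x\<^sup>2 + \<epsilon>)) powr \<alpha>
          \<le> u z - N * ((?y + 0 / b)\<^sup>2 + (?x\<^sup>2 + \<epsilon>)) powr \<alpha>" if "\<bar>t\<bar> < d" for t
        using z_max[OF near[OF that e']] by simp
    qed
    with D(2) show ?thesis by (simp add: s_def add_ac)
  qed
  let ?w = "(s z + \<epsilon>) powr (2 * \<alpha> - 2)"
  have w: "0 < ?w" using s_ne[of z] by simp
  have "N powr p * ?w = (Q z) powr p"
    using N by (simp add: Q_def powr_mult powr_powr alpha(2))
  also have "\<dots> \<le> u z powr p"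
    using gt N p_pos by (intro powr_mono2) (auto simp: Q_def)
  also have "\<dots> \<le> ?B / a\<^sup>2 * (?B / b\<^sup>2)"
    using det_hessian_le[OF convex_u zS e B1 B2] det_eq[OF zS] by simp
  also have "\<dots> = 16 * \<alpha> ^ 4 * N\<^sup>2 * ((s z + \<epsilon>) powr (\<alpha> - 1) * (s z + \<epsilon>) powr (\<alpha> - 1)) / (a * b)\<^sup>2"
    by (simp add: power2_eq_square power4_eq_xxxx field_simps)
  also have "(s z + \<epsilon>) powr (\<alpha> - 1) * (s z + \<epsilon>) powr (\<alpha> - 1) = ?w"
    by (simp flip: powr_add)
  finally have "N powr p * ?w * (a * b)\<^sup>2 \<le> 16 * \<alpha> ^ 4 * N\<^sup>2 * ?w"
    using ab by (simp add: pos_le_divide_eq)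
  then have "?w * (N powr p * (a * b)\<^sup>2) \<le> ?w * (16 * \<alpha> ^ 4 * N\<^sup>2)"
    by (simp only: mult_ac)
  then have "N powr p * (a * b)\<^sup>2 \<le> 16 * \<alpha> ^ 4 * N\<^sup>2"
    by (rule mult_left_le_imp_le) (rule w)
  also have "N\<^sup>2 = N powr p * N powr (2 - p)"
    using N by (simp flip: powr_add)
  finally have "N powr p * (a * b)\<^sup>2 \<le> N powr p * (16 * \<alpha> ^ 4 * N powr (2 - p))"
    by (simp only: mult_ac)
  then show ?thesis
    by (rule mult_left_le_imp_le) (use N in auto)
qed

text \<open>The convex hull of \<open>x\<close> and the ball contains an ellipse centred midway,
  with semi-axes \<open>R / 4\<close> along the segment and \<open>r / 4\<close> across it.
  Convexity bounds \<open>u\<close> on it by the larger of \<open>u x\<close> and \<open>M\<close>,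
  and the area bound then limits \<open>R\<close>.\<close>

lemma growth:
  assumes r: "0 < r" "cball z r \<subseteq> S" "\<And>y. y \<in> cball z r \<Longrightarrow> u y \<le> M" and x: "x \<in> S"
  shows "norm (x - z) \<le> 64 * \<alpha>\<^sup>2 / r * (max (u x) M) powr (1 - p / 2)"
proof (cases "x = z")
  case False
  define N where "N = max (u x) M"
  define R where "R = norm (x - z)"
  have R: "0 < R" using False by (simp add: R_def)
  define e where "e = (x - z) /\<^sub>R R"
  have e: "norm e = 1" using R by (simp add: e_def R_def)
  have xz: "x = z + R *\<^sub>R e" using R by (simp add: e_def)
  define c where "c = z + (R / 2) *\<^sub>R e"
  have in_ellipse: "y \<in> S \<and> u y \<le> N" if y: "y \<in> ellipse c e (R / 4) (r / 4)" for y
  proof -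
    define a b where "a = (y - c) \<bullet> e" and "b = (y - c) \<bullet> perp e"
    have ab: "\<bar>a\<bar> \<le> R / 4" "\<bar>b\<bar> \<le> r / 4"
      using ellipse_bounds[OF y] R r by (auto simp: a_def b_def)
    \<comment> \<open>\<open>l\<close> is the weight of the ball point when \<open>y\<close> is
      written as a convex combination of it and \<open>x\<close>. Since
      \<open>l \<ge> 1 / 4\<close>, the offset \<open>b / l\<close> stays within
      \<open>r\<close>.\<close>
    define l where "l = 1 / 2 - a / R"
    have "\<bar>a / R\<bar> \<le> 1 / 4" using ab R by (simp add: pos_divide_le_eq)
    then have l: "1 / 4 \<le> l" "l \<le> 3 / 4" 
      using abs_le_D1[of "a / R" "1 / 4"] abs_le_D2[of "a / R" "1 / 4"] unfolding l_def by linarith+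
    have "\<bar>b\<bar> / l \<le> (r / 4) / (1 / 4)" using ab l r by (intro frac_le) auto
    then have z': "z + (b / l) *\<^sub>R perp e \<in> cball z r"
      using e l by (simp add: dist_norm)
    have "y = c + a *\<^sub>R e + b *\<^sub>R perp e"
      using perp_expansion[OF e, of "y - c"] by (simp add: a_def b_def algebra_simps)
    also have "\<dots> = z + ((1 - l) * R) *\<^sub>R e + b *\<^sub>R perp e"
      using R by (simp add: c_def l_def algebra_simps)
    also have "\<dots> = (1 - l) *\<^sub>R x + l *\<^sub>R (z + (b / l) *\<^sub>R perp e)"
      using l by (simp add: xz algebra_simps)
    finally have y_eq: "y = (1 - l) *\<^sub>R x + l *\<^sub>R (z + (b / l) *\<^sub>R perp e)" .
    have "y \<in> S"
      unfolding y_eq using convex_S x z' r(2) l by (intro convexD) auto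
    moreover have "u y \<le> (1 - l) * u x + l * u (z + (b / l) *\<^sub>R perp e)"
      unfolding y_eq using convex_u x z' r(2) l by (intro convex_onD) auto
    moreover have "\<dots> \<le> (1 - l) * N + l * N"
      using r(3)[OF z'] l by (intro add_mono mult_left_mono) (auto simp: N_def)
    ultimately show ?thesis by (simp add: algebra_simps)
  qed
  have N: "0 < N" using u_pos[OF x] by (auto simp: N_def)
  have "((R / 4) * (r / 4))\<^sup>2 \<le> 16 * \<alpha> ^ 4 * N powr (2 - p)"
    using in_ellipse R r(1) by (intro ellipse_area_bound[OF e]) auto
  also have "\<dots> = (4 * \<alpha>\<^sup>2 * N powr (1 - p / 2))\<^sup>2"
    using N by (simp add: power_mult_distrib power2_eq_square power4_eq_xxxx flip: powr_add)
  finally have "(R / 4) * (r / 4) \<le> 4 * \<alpha>\<^sup>2 * N powr (1 - p / 2)"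
    by (rule power2_le_imp_le) simp
  then show ?thesis using r(1) by (simp add: R_def N_def field_simps)
qed (use r p_less in auto)

text \<open>The exponent lies strictly between 0 and 1, so \<open>u\<close> must grow faster than
  linearly in any direction in which \<open>S\<close> extends to infinity.\<close>

lemma superlinear_growth:
  assumes "S \<noteq> {}"
  obtains z C B where "0 < C"
    "\<And>x. x \<in> S \<Longrightarrow> norm (x - z) \<le> C * (max (u x) B) powr (1 - p / 2)"
proof -
  obtain z where "z \<in> S" using assms by blast
  then obtain r where r: "0 < r" "cball z r \<subseteq> S"
    using open_S open_contains_cball by blast
  then have "\<exists>y\<in>cball z r. \<forall>x\<in>cball z r. u x \<le> u y"
    by (intro continuous_attains_sup continuous_on_u) auto
  then obtain B where B: "\<And>y. y \<in> cball z r \<Longrightarrow> u y \<le> B" by blast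
  show thesis
  proof (rule that)
    show "0 < 64 * \<alpha>\<^sup>2 / r" using alpha r by simp
    show "norm (x - z) \<le> 64 * \<alpha>\<^sup>2 / r * (max (u x) B) powr (1 - p / 2)" if "x \<in> S" for x
      using growth[OF r B that] .
  qed
qed

text \<open>The growth estimate gives boundedness. Blow-up at the frontier keeps limit points inside
  the open set \<open>S\<close>, so the sublevel set is closed in the whole plane.\<close>

lemma compact_sublevel: "compact {x \<in> S. u x \<le> M}"
proof (cases "S = {}")
  case False
  then obtain z C B where C: "0 < C"
    and gr: "\<And>x. x \<in> S \<Longrightarrow> norm (x - z) \<le> C * (max (u x) B) powr (1 - p / 2)"
    using superlinear_growth by blast
  have "norm (x - z) \<le> C * (max M B) powr (1 - p / 2)" if "x \<in> S" "u x \<le> M" for x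
  proof -
    have "(max (u x) B) powr (1 - p / 2) \<le> (max M B) powr (1 - p / 2)"
      using that u_pos[of x] p_less by (intro powr_mono2) auto
    then show ?thesis
      using gr[OF that(1)] C by (meson less_imp_le mult_left_mono order_trans)
  qed
  then have bdd: "bounded {x \<in> S. u x \<le> M}"
    by (intro boundedI[of _ "norm z + C * (max M B) powr (1 - p / 2)"])
      (smt (verit) mem_Collect_eq norm_triangle_sub)
  have "closed {x \<in> S. u x \<le> M}"
    unfolding closed_sequential_limits
  proof safe
    fix f x assume f: "\<forall>n. f n \<in> {x \<in> S. u x \<le> M}" and lim: "f \<longlonglongrightarrow> x"
    show "x \<in> S"
    proof (rule ccontr)
      assume "x \<notin> S"
      have "x \<in> closure S" using f lim closure_sequential by blast
      then have "x \<in> frontier S" using \<open>x \<notin> S\<close> open_S by (simp add: frontier_def interior_open)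
      then have "filterlim u at_top (at x within S)" by (rule blowup)
      moreover have "filterlim f (at x within S) sequentially"
        unfolding filterlim_at using lim f \<open>x \<notin> S\<close> by (auto intro!: always_eventually)
      ultimately have "filterlim (\<lambda>n. u (f n)) at_top sequentially" by (rule filterlim_compose)
      then have "\<forall>\<^sub>F n in sequentially. M < u (f n)" by (simp add: filterlim_at_top_dense)
      then show False using f by (auto simp: eventually_sequentially not_less[symmetric])
    qed
    have "isCont u x"
      using \<open>x \<in> S\<close> continuous_on_u[OF order_refl] open_S by (simp add: continuous_on_eq_continuous_at)
    then have "(\<lambda>n. u (f n)) \<longlonglongrightarrow> u x" using lim by (rule isCont_tendsto_compose)
    then show "u x \<le> M" using f by (intro LIMSEQ_le_const2[of _ "u x"]) auto
  qed
  with bdd show ?thesis by (simp add: compact_eq_bounded_closed)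
qed simp

text \<open>The quadratic \<open>V\<close> lies below the plane \<open>l\<close> on the section
  \<open>T\<close> but above \<open>u\<close> at \<open>x0\<close>. Hence \<open>V - u\<close> has a
  maximum at a point \<open>y\<close> interior to \<open>T\<close>, where the Hessian of
  \<open>u\<close> dominates that of \<open>V\<close>, whose determinant is
  \<open>(N / (\<delta> * \<rho>))\<^sup>2\<close>; the equation bounds it by
  \<open>K powr p\<close>.\<close>

lemma section_height:
  assumes e: "norm e = 1" and t_pos: "\<And>x. x \<in> S \<Longrightarrow> 0 < (x - w) \<bullet> e"
    and x0: "x0 \<in> S" and dr: "0 < \<delta>" "0 < \<rho>"
    and l_def: "\<And>x. l x = 2 * u x0 + k * ((x0 - x) \<bullet> e)"
    and sec: "\<And>x. x \<in> S \<Longrightarrow> u x \<le> l x \<Longrightarrow>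
      (x - w) \<bullet> e \<le> \<delta> \<and> \<bar>(x - z) \<bullet> perp e\<bar> \<le> \<rho> \<and> l x \<le> K"
  shows "(u x0)\<^sup>2 \<le> (\<delta> * \<rho>)\<^sup>2 * K powr p"
proof -
  define N where "N = u x0"
  have N: "0 < N" using u_pos[OF x0] by (simp add: N_def)
  define T where "T = {x \<in> S. u x \<le> l x}"
  \<comment> \<open>On \<open>T\<close> each square is at most 1, so \<open>V \<le> l\<close>. At
    \<open>x0\<close> the correction exceeds \<open>- N\<close>, as the first square is positive
    there, and \<open>l x0 = 2 * N\<close>.\<close>
  define V where "V x = l x + N / 2 * ((((x - w) \<bullet> e) / \<delta>)\<^sup>2 + (((x - z) \<bullet> perp e) / \<rho>)\<^sup>2 - 2)" for x
  have l_cont: "continuous_on A l" for A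
    unfolding l_def by (intro continuous_intros)
  \<comment> \<open>Because \<open>l \<le> K\<close> on \<open>T\<close>, the section lies in a
    compact sublevel set; this gives compactness although \<open>S\<close> is open.\<close>
  have "T = {x \<in> S. u x \<le> K} \<inter> {x \<in> {x \<in> S. u x \<le> K}. u x \<le> l x}"
    using sec by (force simp: T_def)
  moreover have "closed {x \<in> {x \<in> S. u x \<le> K}. u x \<le> l x}"
    using compact_sublevel[of K, THEN compact_imp_closed]
    by (intro continuous_on_closed_Collect_le[OF continuous_on_u l_cont]) auto
  ultimately have "compact T" using compact_sublevel[of K] by (simp add: compact_Int_closed)
  have x0T: "x0 \<in> T" using x0 N by (simp add: T_def l_def N_def)
  have "continuous_on T (\<lambda>x. V x - u x)"
    unfolding V_def using dr
    by (intro continuous_intros l_cont continuous_on_u) (auto simp: T_def)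
  moreover have "T \<noteq> {}" using x0T by blast
  ultimately have "\<exists>y\<in>T. \<forall>x\<in>T. V x - u x \<le> V y - u y"
    by (intro continuous_attains_sup \<open>compact T\<close>)
  then obtain y where y: "y \<in> T" and y_max: "\<And>x. x \<in> T \<Longrightarrow> V x - u x \<le> V y - u y"
    by blast
  have yS: "y \<in> S" using y by (simp add: T_def)
  have "u x0 < V x0"
  proof -
    have "0 < (((x0 - w) \<bullet> e) / \<delta>)\<^sup>2"
      using t_pos[OF x0] dr by simp
    then have "0 < N / 2 * ((((x0 - w) \<bullet> e) / \<delta>)\<^sup>2 + (((x0 - z) \<bullet> perp e) / \<rho>)\<^sup>2)"
      using N by (intro mult_pos_pos add_pos_nonneg) auto
    then show ?thesis by (simp add: V_def l_def N_def algebra_simps)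
  qed
  then have gt: "u y < V y" using y_max[OF x0T] by simp
  have "V y \<le> l y"
  proof -
    have "0 \<le> (y - w) \<bullet> e" "(y - w) \<bullet> e \<le> \<delta>" "\<bar>(y - z) \<bullet> perp e\<bar> \<le> \<rho>"
      using t_pos[OF yS] sec[OF yS] y by (auto simp: T_def)
    then have "(((y - w) \<bullet> e) / \<delta>)\<^sup>2 \<le> 1" "(((y - z) \<bullet> perp e) / \<rho>)\<^sup>2 \<le> 1"
      using dr by (auto simp: abs_square_le_1)
    then show ?thesis using N by (simp add: V_def mult_le_0_iff)
  qed
  have "u y < l y" using gt \<open>V y \<le> l y\<close> by simp
  \<comment> \<open>Strictness at \<open>y\<close> puts a whole ball around \<open>y\<close> inside
    \<open>T\<close>, so the maximum there is a local one in the plane.\<close>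
  have "open {x \<in> S. u x < l x}"
    using open_Collect_less_Int[OF continuous_on_u[OF order_refl] l_cont[of S]] open_S
    by (metis open_Int)
  then obtain d where d: "0 < d" "ball y d \<subseteq> {x \<in> S. u x < l x}"
    using \<open>u y < l y\<close> yS unfolding open_contains_ball by blast
  have "N / \<delta>\<^sup>2 * (N / \<rho>\<^sup>2) \<le> det (H y)"
  proof (rule det_ge_of_quadratic_form_ge[OF e])
    fix h :: "real^2" assume h: "norm h = 1"
    let ?a = "(y - w) \<bullet> e" and ?b = "(y - z) \<bullet> perp e"
    let ?i = "h \<bullet> e" and ?j = "h \<bullet> perp e"
    define q where "q t = l y - k * (t * ?i) + N / 2 * (((?a + t * ?i) / \<delta>)\<^sup>2 + ((?b + t * ?j) / \<rho>)\<^sup>2 - 2)" for t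
    have Vq: "V (y + t *\<^sub>R h) = q t" for t
      by (simp add: V_def q_def l_def inner_diff_left inner_add_left algebra_simps)
    have "N * (?i\<^sup>2 / \<delta>\<^sup>2 + ?j\<^sup>2 / \<rho>\<^sup>2) \<le> h \<bullet> (H y *v h)"
    proof (rule hessian_ge_at_local_min[OF yS h d(1)])
      show "(q has_real_derivative - k * ?i + N * ((?a + t * ?i) / \<delta> * (?i / \<delta>) + (?b + t * ?j) / \<rho> * (?j / \<rho>))) (at t)" for t
        unfolding q_def using dr
        by (auto intro!: derivative_eq_intros simp: field_simps power2_eq_square)
      show "((\<lambda>t. - k * ?i + N * ((?a + t * ?i) / \<delta> * (?i / \<delta>) + (?b + t * ?j) / \<rho> * (?j / \<rho>)))
          has_real_derivative N * (?i\<^sup>2 / \<delta>\<^sup>2 + ?j\<^sup>2 / \<rho>\<^sup>2)) (at 0)"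
        using dr by (auto intro!: derivative_eq_intros simp: field_simps power2_eq_square)
      show "u y - q 0 \<le> u (y + t *\<^sub>R h) - q t" if "\<bar>t\<bar> < d" for t
      proof -
        have "y + t *\<^sub>R h \<in> ball y d" using that h by (simp add: dist_norm)
        then have "y + t *\<^sub>R h \<in> T" using d(2) by (auto simp: T_def)
        then show ?thesis using y_max[of "y + t *\<^sub>R h"] Vq[of t] Vq[of 0] by simp
      qed
    qed
    then show "N / \<delta>\<^sup>2 * ?i\<^sup>2 + N / \<rho>\<^sup>2 * ?j\<^sup>2 \<le> h \<bullet> (H y *v h)"
      by (simp add: algebra_simps)
  qed (use N in auto)
  also have "\<dots> \<le> K powr p"
    using det_eq[OF yS] u_pos[OF yS] \<open>u y < l y\<close> sec[OF yS] p_pos by (auto intro!: powr_mono2)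
  finally show ?thesis
    using dr by (simp add: N_def power_mult_distrib power2_eq_square field_simps)
qed

section \<open>Minimisers under steep tilts towards a supporting line, and the contradiction\<close>

lemma exists_minimizer:
  assumes t_pos: "\<And>x. x \<in> S \<Longrightarrow> 0 < (x - w) \<bullet> e" and "0 \<le> k" "S \<noteq> {}"
  obtains x where "x \<in> S" "\<And>y. y \<in> S \<Longrightarrow> u x + k * ((x - w) \<bullet> e) \<le> u y + k * ((y - w) \<bullet> e)"
proof -
  obtain a where a: "a \<in> S" using assms by blast
  \<comment> \<open>The tilt is nonnegative, so a point with \<open>u\<close> above the tilted value
    \<open>M\<close> at \<open>a\<close> cannot beat \<open>a\<close>; the minimum over a compact
    sublevel set is therefore global.\<close>
  define M where "M = u a + k * ((a - w) \<bullet> e)"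
  have kt: "0 \<le> k * ((x - w) \<bullet> e)" if "x \<in> S" for x
    using t_pos[OF that] assms(2) by simp
  have aM: "a \<in> {x \<in> S. u x \<le> M}" using a kt[OF a] by (simp add: M_def)
  have "continuous_on {x \<in> S. u x \<le> M} (\<lambda>x. u x + k * ((x - w) \<bullet> e))"
    by (intro continuous_intros continuous_on_u) auto
  moreover have "{x \<in> S. u x \<le> M} \<noteq> {}" using aM by blast
  ultimately have "\<exists>x\<in>{x \<in> S. u x \<le> M}. \<forall>y\<in>{x \<in> S. u x \<le> M}.
      u x + k * ((x - w) \<bullet> e) \<le> u y + k * ((y - w) \<bullet> e)"
    by (intro continuous_attains_inf compact_sublevel)
  then obtain x where x: "x \<in> S" "u x \<le> M"
    "\<And>y. y \<in> S \<Longrightarrow> u y \<le> M \<Longrightarrow> u x + k * ((x - w) \<bullet> e) \<le> u y + k * ((y - w) \<bullet> e)"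
    by blast
  have "u x + k * ((x - w) \<bullet> e) \<le> u y + k * ((y - w) \<bullet> e)" if y: "y \<in> S" for y
  proof (cases "u y \<le> M")
    case False
    then show ?thesis using x(3)[of a] aM kt[OF y] by (simp add: M_def)
  qed (use x y in auto)
  then show thesis using that x(1) by blast
qed

text \<open>The sections at the minimisers \<open>X j\<close> become thin in direction
  \<open>e\<close>, and their length is controlled by the growth estimate. At exactly that rate the
  powers of \<open>K\<close> in \<open>section_height\<close> combine to \<open>K\<^sup>2\<close>,
  leaving a fixed multiple of the squared width to be at least 1.\<close>

lemma not_exists_support:
  assumes e: "norm e = 1" and t_pos: "\<And>x. x \<in> S \<Longrightarrow> 0 < (x - w) \<bullet> e" and w: "w \<in> closure S"
  shows False
proof -
  have ne: "S \<noteq> {}" using w by auto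
  define t where "t x = (x - w) \<bullet> e" for x
  have t: "0 < t x" if "x \<in> S" for x using t_pos[OF that] by (simp add: t_def)
  have "\<exists>x. x \<in> S \<and> (\<forall>y\<in>S. u x + 2 ^ j * t x \<le> u y + 2 ^ j * t y)" for j :: nat
    using exists_minimizer[OF t_pos _ ne, of "2 ^ j"] unfolding t_def by (metis zero_le_numeral zero_le_power)
  then obtain X where X: "\<And>j. X j \<in> S"
    and X_min: "\<And>j y. y \<in> S \<Longrightarrow> u (X j) + 2 ^ j * t (X j) \<le> u y + 2 ^ j * t y"
    by metis
  define N T where "N j = u (X j)" and "T j = t (X j)" for j
  have N: "0 < N j" and T: "0 < T j" for j using X u_pos t by (auto simp: N_def T_def)
  have step: "N j + 2 ^ j * (T j - T (Suc j)) \<le> N (Suc j)" for j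
    using X_min[OF X, of j "Suc j"] by (simp add: N_def T_def algebra_simps)
  \<comment> \<open>If this failed from \<open>J\<close> on, \<open>step\<close> would at least
    double \<open>N\<close> each time, so \<open>N j \<ge> c * 2 ^ j\<close>; then \<open>T\<close>
    would drop by more than \<open>c\<close> at each step and become negative.\<close>
  have slow: "\<exists>j\<ge>J. 2 ^ j * (T j - T (Suc j)) \<le> N j" for J
  proof (rule ccontr)
    assume "\<not> ?thesis"
    then have fast: "N j < 2 ^ j * (T j - T (Suc j))" if "J \<le> j" for j
      using that by (meson not_le)
    define c where "c = N J / 2 ^ J"
    have c: "0 < c" using N by (simp add: c_def)
    have N_ge: "c * 2 ^ (J + i) \<le> N (J + i)" for i
    proof (induction i)
      case (Suc i)
      have "2 * N (J + i) \<le> N (Suc (J + i))" using step[of "J + i"] fast[of "J + i"] by simp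
      with Suc show ?case by simp
    qed (simp add: c_def)
    have "T (J + i) \<le> T J - real i * c" for i
    proof (induction i)
      case (Suc i)
      have "c * 2 ^ (J + i) < 2 ^ (J + i) * (T (J + i) - T (Suc (J + i)))"
        by (rule le_less_trans[OF N_ge fast]) simp
      then have "2 ^ (J + i) * c < 2 ^ (J + i) * (T (J + i) - T (Suc (J + i)))"
        by (subst mult.commute)
      then have "c < T (J + i) - T (Suc (J + i))" by (rule mult_left_less_imp_less) simp
      with Suc show ?case by (simp add: algebra_simps)
    qed simp
    moreover obtain i :: nat where "T J < real i * c"
      using c reals_Archimedean3 by blast
    ultimately show False using T[of "J + i"] by (smt (verit))
  qed
  \<comment> \<open>Testing minimality against a fixed \<open>x\<close> near \<open>w\<close> and
    dividing by \<open>2 ^ j\<close> bounds the sum by \<open>t x + u x / 2 ^ j\<close>. Both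
    summands are needed to control \<delta>.\<close>
  have small: "\<exists>J. \<forall>j\<ge>J. T j + N j / 2 ^ j < \<epsilon>" if "0 < \<epsilon>" for \<epsilon>
  proof -
    obtain x where x: "x \<in> S" "dist x w < \<epsilon> / 2"
      using w \<open>0 < \<epsilon>\<close> unfolding closure_approachable by (meson half_gt_zero)
    have "t x \<le> norm (x - w) * norm e" unfolding t_def by (rule norm_cauchy_schwarz)
    then have tx: "t x < \<epsilon> / 2" using x e by (simp add: dist_norm)
    obtain J :: nat where J: "2 * u x / \<epsilon> < 2 ^ J"
      using real_arch_pow[of 2 "2 * u x / \<epsilon>"] by auto
    have "T j + N j / 2 ^ j < \<epsilon>" if "J \<le> j" for j
    proof -
      have "(2::real) ^ J \<le> 2 ^ j" using that by simp
      then have "2 * u x / \<epsilon> < 2 ^ j" using J by linarith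
      then have "u x / 2 ^ j < \<epsilon> / 2" using \<open>0 < \<epsilon>\<close> by (simp add: field_simps)
      moreover have "(N j + 2 ^ j * T j) / 2 ^ j \<le> (u x + 2 ^ j * t x) / 2 ^ j"
        using X_min[OF x(1), of j] by (intro divide_right_mono) (simp_all add: N_def T_def)
      then have "T j + N j / 2 ^ j \<le> t x + u x / 2 ^ j"
        by (simp add: add_divide_distrib)
      ultimately show ?thesis using tx by linarith
    qed
    then show ?thesis by blast
  qed
  \<comment> \<open>On the compact set where \<open>u \<le> M\<close> the distance \<open>t\<close>
    has a positive minimum, whereas \<open>T j\<close> tends to 0.\<close>
  have large: "\<exists>J. \<forall>j\<ge>J. M < N j" for M
  proof -
    obtain \<eta> where \<eta>: "0 < \<eta>" "\<And>x. x \<in> S \<Longrightarrow> u x \<le> M \<Longrightarrow> \<eta> \<le> t x"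
    proof (cases "{x \<in> S. u x \<le> M} = {}")
      case True
      then show ?thesis using that[of 1] by auto
    next
      case False
      have "continuous_on {x \<in> S. u x \<le> M} t" unfolding t_def by (intro continuous_intros)
      then obtain a where "a \<in> {x \<in> S. u x \<le> M}" "\<forall>x\<in>{x \<in> S. u x \<le> M}. t a \<le> t x"
        using continuous_attains_inf[OF compact_sublevel False] by blast
      then show ?thesis using that[of "t a"] t by auto
    qed
    obtain J where J: "\<And>j. J \<le> j \<Longrightarrow> T j + N j / 2 ^ j < \<eta>" using small[OF \<eta>(1)] by blast
    have "M < N j" if "J \<le> j" for j
    proof (rule ccontr)
      assume "\<not> M < N j"
      then have "\<eta> \<le> T j" using \<eta>(2)[OF X] by (simp add: N_def T_def)
      moreover have "0 < N j / 2 ^ j" using N by simp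
      ultimately show False using J[OF that] by linarith
    qed
    then show ?thesis by blast
  qed
  obtain z C B where C: "0 < C"
    and gr: "\<And>x. x \<in> S \<Longrightarrow> norm (x - z) \<le> C * (max (u x) B) powr (1 - p / 2)"
    using superlinear_growth[OF ne] by blast
  \<comment> \<open>This threshold gives \<open>\<delta> < 1 / (4 * C)\<close>, where the 4 matches
    \<open>K = 4 * N j\<close>.\<close>
  obtain J1 where J1: "\<And>j. J1 \<le> j \<Longrightarrow> T j + N j / 2 ^ j < 1 / (8 * C)"
    using small[of "1 / (8 * C)"] C by auto
  obtain J2 where J2: "\<And>j. J2 \<le> j \<Longrightarrow> B < N j" using large by blast
  obtain j where j: "max J1 J2 \<le> j" and Dj: "2 ^ j * (T j - T (Suc j)) \<le> N j"
    using slow by blast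
  define K where "K = 4 * N j"
  \<comment> \<open>Positivity of \<open>u\<close> in \<open>u \<le> l\<close> forces
    \<open>t \<le> \<delta>\<close> on the section.\<close>
  define \<delta> where "\<delta> = T j + 2 * N j / 2 ^ j"
  define \<rho> where "\<rho> = C * K powr (1 - p / 2)"
  have BK: "B \<le> K" using J2[of j] j N[of j] by (simp add: K_def)
  have K: "0 < K" using N by (simp add: K_def)
  have d: "0 < \<delta>" "0 < \<rho>" using T N C K by (auto simp: \<delta>_def \<rho>_def intro!: add_pos_pos)
  have "(N j)\<^sup>2 \<le> (\<delta> * \<rho>)\<^sup>2 * K powr p"
    unfolding N_def
  proof (rule section_height[OF e t_pos X d, where k = "2 ^ j"
        and l = "\<lambda>x. 2 * u (X j) + 2 ^ j * ((X j - x) \<bullet> e)", OF _ refl])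
    fix x assume x: "x \<in> S" and le: "u x \<le> 2 * u (X j) + 2 ^ j * ((X j - x) \<bullet> e)"
    have l_eq: "(X j - x) \<bullet> e = T j - t x"
      by (simp add: T_def t_def inner_diff_left)
    have le': "u x \<le> 2 * N j + 2 ^ j * (T j - t x)" using le l_eq by (simp add: N_def)
    have "2 ^ j * t x \<le> 2 ^ j * \<delta>"
      using le' u_pos[OF x] by (simp add: \<delta>_def algebra_simps)
    then have 1: "t x \<le> \<delta>" by simp
    \<comment> \<open>Minimality at the doubled slope bounds \<open>t x\<close> from below on the
      section, so the plane at \<open>x\<close> is at most
      \<open>4 * N j - N (Suc j) + 2 * 2 ^ j * (T j - T (Suc j))\<close>. Then \<open>step\<close>
      lowers this to \<open>3 * N j + 2 ^ j * (T j - T (Suc j))\<close>, and \<open>Dj\<close> to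
      \<open>K\<close>.\<close>
    have "N (Suc j) + 2 * 2 ^ j * T (Suc j) \<le> u x + 2 * 2 ^ j * t x"
      using X_min[OF x, of "Suc j"] by (simp add: N_def T_def)
    then have 2: "2 * N j + 2 ^ j * (T j - t x) \<le> K"
      using le' step[of j] Dj by (simp add: K_def algebra_simps)
    have "\<bar>(x - z) \<bullet> perp e\<bar> \<le> norm (x - z) * norm (perp e)"
      by (rule Cauchy_Schwarz_ineq2)
    also have "\<dots> \<le> C * (max (u x) B) powr (1 - p / 2)"
      using gr[OF x] e by simp
    also have "\<dots> \<le> \<rho>"
      using u_pos[OF x] le' 2 BK p_less C unfolding \<rho>_def
      by (intro mult_left_mono powr_mono2) auto
    finally show "(x - w) \<bullet> e \<le> \<delta> \<and> \<bar>(x - z) \<bullet> perp e\<bar> \<le> \<rho> \<and>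
        2 * u (X j) + 2 ^ j * ((X j - x) \<bullet> e) \<le> K"
      using 1 2 l_eq by (simp add: t_def N_def)
  qed
  also have "(\<delta> * \<rho>)\<^sup>2 * K powr p = (\<delta> * C)\<^sup>2 * (K powr (1 - p / 2) * K powr (1 - p / 2) * K powr p)"
    by (simp add: \<rho>_def power2_eq_square)
  also have "K powr (1 - p / 2) * K powr (1 - p / 2) * K powr p = K\<^sup>2"
    using K by (simp flip: powr_add)
  also have "(\<delta> * C)\<^sup>2 * K\<^sup>2 = (4 * \<delta> * C)\<^sup>2 * (N j)\<^sup>2"
    by (simp add: K_def power_mult_distrib)
  finally have "1 \<le> (4 * \<delta> * C)\<^sup>2" using N[of j] by simp
  moreover have "4 * \<delta> * C < 1"
  proof -
    have "\<delta> < 2 * (1 / (8 * C))" using J1[of j] j T[of j] by (simp add: \<delta>_def)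
    then show ?thesis using C by (simp add: field_simps)
  qed
  then have "(4 * \<delta> * C)\<^sup>2 < 1" using d C by (simp add: abs_square_less_1)
  ultimately show False by simp
qed

text \<open>Otherwise there is a frontier point, which lies outside the open set \<open>S\<close>. A
  supporting line there meets \<open>S\<close> nowhere, so the distance to it is strictly positive
  on \<open>S\<close>.\<close>

lemma domain_trivial: "S = {} \<or> S = UNIV"
proof (rule ccontr)
  assume "\<not> ?thesis"
  then obtain w where w: "w \<in> frontier S" using frontier_eq_empty[of S] by blast
  then have w': "w \<in> closure S" "w \<notin> rel_interior S"
    using open_S by (auto simp: frontier_def interior_open rel_interior_open)
  from supporting_hyperplane_relative_frontier[OF convex_S this]
  obtain a where a: "a \<noteq> 0" "\<And>y. y \<in> S \<Longrightarrow> a \<bullet> w < a \<bullet> y"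
    using rel_interior_open[OF open_S] by metis
  show False
  proof (rule not_exists_support[OF _ _ w'(1)])
    show "norm (sgn a) = 1" using a by (simp add: norm_sgn)
    show "0 < (x - w) \<bullet> sgn a" if "x \<in> S" for x
      using a(1) a(2)[OF that] by (simp add: sgn_div_norm inner_diff_left inner_diff_right inner_commute)
  qed
qed

end

theorem theorem1p6:
  fixes \<Omega> :: "(real^2) set" and p :: real
  assumes "0 < p" and "p < 1/2"
    and "open \<Omega>" and "connected \<Omega>" and "convex \<Omega>"
    and "\<Omega> \<noteq> UNIV" and "\<not> bounded \<Omega>"
  shows "\<not> (\<exists>u g H. C2_with_hessian u g H \<Omega>
             \<and> (\<forall>x\<in>\<Omega>. 0 < u x)
             \<and> convex_on \<Omega> u
             \<and> (\<forall>x\<in>\<Omega>. det (H x) = u x powr p)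
             \<and> (\<forall>y\<in>frontier \<Omega>. filterlim u at_top (at y within \<Omega>)))"
proof safe
  fix u g H
  assume "C2_with_hessian u g H \<Omega>" "\<forall>x\<in>\<Omega>. 0 < u x" "convex_on \<Omega> u"
    "\<forall>x\<in>\<Omega>. det (H x) = u x powr p" "\<forall>y\<in>frontier \<Omega>. filterlim u at_top (at y within \<Omega>)"
  with assms have "blowup_solution u g H \<Omega> p"
    by unfold_locales auto
  then have "\<Omega> = {} \<or> \<Omega> = UNIV" by (rule blowup_solution.domain_trivial)
  with \<open>\<Omega> \<noteq> UNIV\<close> \<open>\<not> bounded \<Omega>\<close> show False by auto
qed

end
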